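(* Let $F$ be an Archimedean vector lattice, let $\mathcal{I}_F$ be the lattice of all (vector lattice) ideals of $F$, and let $H\in\mathcal{I}_F$. Then $H$ is a projection band in $F$ if and only if $\mathcal{I}_F$ is infinite-meet distributive at $H$, i.e. for every collection $\mathcal{J}\subset\mathcal{I}_F$, $$\bigcap_{J\in\mathcal{J}}(H+J)\subset H+\bigcap\mathcal{J}.$$
   Context: An ideal of a vector lattice $F$ is a linear subspace $E\subset F$ such that $|f|\le|e|$, $e\in E$, $f\in F$ imply $f\in E$. The set $\mathcal{I}_F$ of all ideals of $F$ is ordered by inclusion; joins of two ideals are sums and meets are intersections (the empty intersection being $F$). For $G\subset F$, $G^d=\{f\in F: |f|\wedge|g|=0 \text{ for all } g\in G\}$. An ideal $H\subset F$ is a projection band if $F=H+H^d$. *)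

theory Defs
  imports
    Complex_Main
    "HOL-Library.Lattice_Algebras"
    "HOL-Library.Set_Algebras"
begin

class vector_lattice = ordered_real_vector + lattice_ab_group_add_abs

class archimedean_vector_lattice = vector_lattice +
  assumes archimedean: "\<lbrakk>0 \<le> x; \<And>n::nat. real n *\<^sub>R x \<le> y\<rbrakk> \<Longrightarrow> x = 0"

instance real :: archimedean_vector_lattice
proof
  fix x y :: real
  assume x: "0 \<le> x" and le: "\<And>n::nat. real n *\<^sub>R x \<le> y"
  show "x = 0"
  proof (rule ccontr)
    assume "x \<noteq> 0"
    with x have "0 < x" by simp
    then obtain n :: nat where "y < real n * x"
      using reals_Archimedean3 by blast
    with le[of n] show False by simp
  qed
qed

definition vl_ideals :: "'a::vector_lattice set set"
  where "vl_ideals =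
    {E. subspace E \<and> (\<forall>e\<in>E. \<forall>f. \<bar>f\<bar> \<le> \<bar>e\<bar> \<longrightarrow> f \<in> E)}"

definition disjoint_complement :: "'a::vector_lattice set \<Rightarrow> 'a set"
  where "disjoint_complement G = {f. \<forall>g\<in>G. inf \<bar>f\<bar> \<bar>g\<bar> = 0}"

text \<open>Sums of sets are the elementwise sums of \<^theory>\<open>HOL-Library.Set_Algebras\<close>.\<close>

definition projection_band :: "'a::vector_lattice set \<Rightarrow> bool"
  where "projection_band H \<longleftrightarrow> H \<in> vl_ideals \<and> H + disjoint_complement H = UNIV"

text \<open>In the lattice of ideals joins of two ideals are sums and meets are intersections.
  The collection \<open>\<J>\<close> may be infinite or empty; the empty intersection is the whole space.\<close>

definition infinite_meet_distributive_at :: "'a::vector_lattice set \<Rightarrow> bool"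
  where "infinite_meet_distributive_at H \<longleftrightarrow>
    (\<forall>\<J> \<subseteq> vl_ideals. (\<Inter>J\<in>\<J>. H + J) \<subseteq> H + \<Inter>\<J>)"

end

theory Submission
  imports Defs
begin

text \<open>If \<open>H\<close> is a projection band, then the component in \<open>H\<^sup>d\<close> of an element of \<open>H + J\<close> is
  dominated by an element of \<open>J\<close> alone, because the part from \<open>H\<close> is disjoint from it. Hence one and
  the same decomposition serves every \<open>J\<close> in the collection
  (\<open>disjoint_component_mem_ideal\<close>), and the distributive law follows.

  For the converse, let \<open>f \<ge> 0\<close>. The idea is to write down ideals \<open>J\<close> with \<open>f \<in> H + J\<close> that are
  jointly so small that their intersection lies in \<open>H\<^sup>d\<close>; the distributive law then
  decomposes \<open>f\<close>. For \<open>h \<in> H\<close> and a natural number \<open>n\<close> put \<open>J = {(n|h| - f)\<^sup>+}\<^sup>d\<close>, heuristically the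
  ideal of elements living where \<open>n|h| \<le> f\<close>. The identity \<open>f = f \<sqinter> n|h| + (f - n|h|)\<^sup>+\<close> shows
  \<open>f \<in> H + J\<close> (\<open>mem_ideal_add_truncation_ideal\<close>). If \<open>g\<close> lies in all these ideals, then
  \<open>u = |g| \<sqinter> |h|\<close> lives where \<open>n|h| \<le> f\<close>, so \<open>n u \<le> f\<close> for every \<open>n\<close>, and the Archimedean
  property gives \<open>u = 0\<close> (\<open>truncation_ideals_Inter_disjoint\<close>).\<close>

section \<open>Disjointness and ideals in vector lattices\<close>

text \<open>Distributing \<open>+\<close> over \<open>\<sqinter>\<close> turns the right-hand side into a meet of four sums: \<open>y + z\<close> and
  three that contain \<open>x\<close> and a further positive element, hence lie above \<open>x\<close>.\<close>

lemma inf_add_le_add_inf: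
  fixes x y z :: "'a::lattice_ab_group_add"
  assumes "0 \<le> x" "0 \<le> y" "0 \<le> z"
  shows "inf x (y + z) \<le> inf x y + inf x z"
proof -
  have "inf x y + inf x z = inf (inf (x + x) (y + x)) (inf (x + z) (y + z))"
    by (simp add: add_inf_distrib_left add_inf_distrib_right)
  moreover have "x \<le> x + x" "x \<le> y + x" "x \<le> x + z"
    using assms by simp_all
  ultimately show ?thesis
    by (simp add: le_infI1)
qed

lemma pprt_diff_pprt_uminus:
  fixes x :: "'a::lattice_ab_group_add"
  shows "pprt x - pprt (- x) = x"
  by (simp add: pprt_neg flip: prts)

lemma inf_pprt_pprt_uminus:
  fixes x :: "'a::lattice_ab_group_add"
  shows "inf (pprt x) (pprt (- x)) = 0"
proof -
  have "pprt x = pprt (- x) + x"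
    using pprt_diff_pprt_uminus[of x] by (simp add: diff_eq_eq add.commute)
  then have "inf (pprt x) (pprt (- x)) = pprt (- x) + inf x 0"
    by (simp add: add_inf_distrib_left)
  also have "\<dots> = 0"
    by (simp add: pprt_neg flip: nprt_def)
  finally show ?thesis .
qed

lemma vl_idealsD:
  assumes "E \<in> vl_ideals"
  shows "subspace E" and "\<And>e f. e \<in> E \<Longrightarrow> \<bar>f\<bar> \<le> \<bar>e\<bar> \<Longrightarrow> f \<in> E"
  using assms by (auto simp: vl_ideals_def)

lemma abs_scaleR_le:
  fixes x :: "'a::vector_lattice"
  shows "\<bar>c *\<^sub>R x\<bar> \<le> \<bar>c\<bar> *\<^sub>R \<bar>x\<bar>"
proof (rule abs_leI)
  have *: "d *\<^sub>R x \<le> \<bar>d\<bar> *\<^sub>R \<bar>x\<bar>" for d :: real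
  proof (cases "0 \<le> d")
    case True
    then show ?thesis by (simp add: scaleR_left_mono abs_ge_self)
  next
    case False
    then have "(- d) *\<^sub>R (- x) \<le> (- d) *\<^sub>R \<bar>x\<bar>"
      by (intro scaleR_left_mono abs_ge_minus_self) simp
    with False show ?thesis by simp
  qed
  show "c *\<^sub>R x \<le> \<bar>c\<bar> *\<^sub>R \<bar>x\<bar>" by (rule *)
  show "- (c *\<^sub>R x) \<le> \<bar>c\<bar> *\<^sub>R \<bar>x\<bar>" using *[of "- c"] by simp
qed

lemma disjoint_mono:
  fixes x y z :: "'a::vector_lattice"
  assumes "inf y \<bar>z\<bar> = 0" "\<bar>x\<bar> \<le> y"
  shows "inf \<bar>x\<bar> \<bar>z\<bar> = 0"
proof (rule antisym)
  show "inf \<bar>x\<bar> \<bar>z\<bar> \<le> 0"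
    using inf_mono[OF assms(2) order_refl, of "\<bar>z\<bar>"] assms(1) by simp
qed simp

lemma disjoint_add:
  fixes x y z :: "'a::vector_lattice"
  assumes "0 \<le> x" "0 \<le> y" "inf x \<bar>z\<bar> = 0" "inf y \<bar>z\<bar> = 0"
  shows "inf (x + y) \<bar>z\<bar> = 0"
proof (rule antisym)
  show "inf (x + y) \<bar>z\<bar> \<le> 0"
    using inf_add_le_add_inf[of "\<bar>z\<bar>" x y] assms by (simp add: inf_commute)
qed (use assms in simp)

lemma disjoint_complement_ideal: "disjoint_complement G \<in> vl_ideals"
proof -
  have add: "inf \<bar>x + y\<bar> \<bar>g\<bar> = 0" if "inf \<bar>x\<bar> \<bar>g\<bar> = 0" "inf \<bar>y\<bar> \<bar>g\<bar> = 0" for x y g :: 'a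
    by (rule disjoint_mono[OF disjoint_add[OF _ _ that] abs_triangle_ineq]) simp_all
  have scale: "inf \<bar>c *\<^sub>R x\<bar> \<bar>g\<bar> = 0" if "inf \<bar>x\<bar> \<bar>g\<bar> = 0" for c and x g :: 'a
  proof -
    \<comment> \<open>Additivity yields natural multiples, and these dominate all real ones.\<close>
    have nat: "inf (real n *\<^sub>R \<bar>x\<bar>) \<bar>g\<bar> = 0" for n
    proof (induction n)
      case 0
      show ?case by (simp add: inf_absorb1)
    next
      case (Suc n)
      then show ?case
        using disjoint_add[of "\<bar>x\<bar>" "real n *\<^sub>R \<bar>x\<bar>" g] that
        by (simp add: scaleR_add_left scaleR_nonneg_nonneg)
    qed
    obtain n where "\<bar>c\<bar> \<le> real n"
      using real_arch_simple by blast
    then have "\<bar>c\<bar> *\<^sub>R \<bar>x\<bar> \<le> real n *\<^sub>R \<bar>x\<bar>"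
      by (intro scaleR_right_mono) simp_all
    then show ?thesis
      by (intro disjoint_mono[OF nat] order_trans[OF abs_scaleR_le])
  qed
  show ?thesis
    unfolding vl_ideals_def disjoint_complement_def subspace_def
    by (auto simp: inf_absorb1 intro: add scale disjoint_mono)
qed

section \<open>Projection bands are infinite-meet distributive\<close>

text \<open>Since \<open>g\<close> is disjoint from the part \<open>h\<close> of the bound \<open>|g| \<le> |h| + |j|\<close>, already \<open>|g| \<le> |j|\<close>.\<close>

lemma disjoint_component_mem_ideal:
  fixes g h j :: "'a::vector_lattice"
  assumes "J \<in> vl_ideals" "j \<in> J" "inf \<bar>g\<bar> \<bar>h\<bar> = 0" "g = h + j"
  shows "g \<in> J"
proof -
  have "\<bar>g\<bar> = inf \<bar>g\<bar> (\<bar>h\<bar> + \<bar>j\<bar>)"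
    using assms(4) abs_triangle_ineq by (metis inf_absorb1)
  also have "\<dots> \<le> inf \<bar>g\<bar> \<bar>h\<bar> + inf \<bar>g\<bar> \<bar>j\<bar>"
    by (rule inf_add_le_add_inf) simp_all
  also have "\<dots> \<le> \<bar>j\<bar>"
    using assms(3) by simp
  finally show ?thesis
    using vl_idealsD(2)[OF assms(1,2)] by blast
qed

lemma projection_band_imp_infinite_meet_distributive:
  fixes H :: "'a::vector_lattice set"
  assumes "projection_band H"
  shows "infinite_meet_distributive_at H"
  unfolding infinite_meet_distributive_at_def
proof (intro allI impI subsetI)
  fix \<J> :: "'a set set" and f
  assume J: "\<J> \<subseteq> vl_ideals" and f: "f \<in> (\<Inter>J\<in>\<J>. H + J)"
  have H: "subspace H" and "f \<in> H + disjoint_complement H"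
    using assms by (auto simp: projection_band_def dest: vl_idealsD)
  then obtain h g where hg: "h \<in> H" "g \<in> disjoint_complement H" "f = h + g"
    by (blast elim: set_plus_elim)
  have "g \<in> J" if "J \<in> \<J>" for J
  proof -
    from f that have "f \<in> H + J"
      by blast
    then obtain h' j where "h' \<in> H" "j \<in> J" "f = h' + j"
      by (rule set_plus_elim)
    with hg H J that show ?thesis
      by (intro disjoint_component_mem_ideal[of J j g "h' - h"])
        (auto simp: disjoint_complement_def subspace_diff algebra_simps)
  qed
  with hg show "f \<in> H + \<Inter>\<J>"
    by auto
qed

section \<open>Infinite-meet distributivity yields the band projection\<close>

text \<open>This stands in for the ideal generated by \<open>(f - n|h|)\<^sup>+\<close>, which it contains: as a disjoint
  complement it is an ideal at once, and the smallness used below is disjointness from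
  \<open>(n|h| - f)\<^sup>+\<close>.\<close>

definition truncation_ideal :: "'a::vector_lattice \<Rightarrow> 'a \<Rightarrow> nat \<Rightarrow> 'a set"
  where "truncation_ideal f h n = disjoint_complement {pprt (real n *\<^sub>R \<bar>h\<bar> - f)}"

lemma mem_ideal_add_truncation_ideal:
  fixes f :: "'a::vector_lattice"
  assumes H: "H \<in> vl_ideals" and "h \<in> H" "0 \<le> f"
  shows "f \<in> H + truncation_ideal f h n"
proof -
  let ?k = "real n *\<^sub>R \<bar>h\<bar>"
  have k: "0 \<le> ?k"
    by (simp add: scaleR_nonneg_nonneg)
  have "\<bar>h\<bar> \<in> H"
    using vl_idealsD(2)[OF H \<open>h \<in> H\<close>] by simp
  then have "?k \<in> H"
    using vl_idealsD(1)[OF H] by (rule subspace_scale[rotated])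
  moreover have "\<bar>inf f ?k\<bar> \<le> \<bar>?k\<bar>"
    using k \<open>0 \<le> f\<close> by (simp add: abs_of_nonneg)
  ultimately have inH: "inf f ?k \<in> H"
    by (rule vl_idealsD(2)[OF H])
  have "inf (pprt (f - ?k)) (pprt (?k - f)) = 0"
    using inf_pprt_pprt_uminus[of "f - ?k"] by simp
  then have inJ: "pprt (f - ?k) \<in> truncation_ideal f h n"
    by (simp add: truncation_ideal_def disjoint_complement_def abs_of_nonneg)
  have "inf f ?k = f + inf 0 (?k - f)"
    by (simp add: add_inf_distrib_left)
  also have "inf 0 (?k - f) = - pprt (f - ?k)"
    by (simp add: pprt_def neg_sup_eq_inf inf_commute)
  finally have "f = inf f ?k + pprt (f - ?k)"
    by simp
  then show ?thesis
    using inH inJ by (metis set_plus_intro)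
qed

text \<open>With \<open>u = |g| \<sqinter> |h|\<close>, the bound \<open>n u \<le> n|h| \<le> f + (n|h| - f)\<^sup>+\<close> improves to \<open>n u \<le> f\<close>, since
  \<open>n u\<close> is disjoint from the second summand. So \<open>u\<close> is infinitesimal relative to \<open>f\<close>; here the
  Archimedean property enters.\<close>

lemma truncation_ideals_Inter_disjoint:
  fixes f g h :: "'a::archimedean_vector_lattice"
  assumes "0 \<le> f" and g: "\<And>n. g \<in> truncation_ideal f h n"
  shows "inf \<bar>g\<bar> \<bar>h\<bar> = 0"
proof (rule archimedean)
  show "0 \<le> inf \<bar>g\<bar> \<bar>h\<bar>"
    by simp
  fix n :: nat
  let ?u = "inf \<bar>g\<bar> \<bar>h\<bar>" and ?p = "pprt (real n *\<^sub>R \<bar>h\<bar> - f)"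
  have J: "truncation_ideal f h n \<in> vl_ideals"
    unfolding truncation_ideal_def by (rule disjoint_complement_ideal)
  have "?u \<in> truncation_ideal f h n"
    by (rule vl_idealsD(2)[OF J g]) (simp add: abs_of_nonneg)
  then have "real n *\<^sub>R ?u \<in> truncation_ideal f h n"
    by (rule subspace_scale[OF vl_idealsD(1)[OF J]])
  moreover have nonneg: "0 \<le> real n *\<^sub>R ?u"
    by (simp add: scaleR_nonneg_nonneg)
  ultimately have disj: "inf (real n *\<^sub>R ?u) ?p = 0"
    by (simp add: truncation_ideal_def disjoint_complement_def abs_of_nonneg)
  have "real n *\<^sub>R ?u \<le> real n *\<^sub>R \<bar>h\<bar>"
    by (intro scaleR_left_mono) simp_all
  also have "\<dots> \<le> f + ?p"
    by (simp add: pprt_def add_sup_distrib_left)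
  finally have "real n *\<^sub>R ?u = inf (real n *\<^sub>R ?u) (f + ?p)"
    by (simp add: inf_absorb1)
  also have "\<dots> \<le> inf (real n *\<^sub>R ?u) f + inf (real n *\<^sub>R ?u) ?p"
    using nonneg \<open>0 \<le> f\<close> by (intro inf_add_le_add_inf) simp_all
  also have "\<dots> \<le> f"
    using disj by simp
  finally show "real n *\<^sub>R ?u \<le> f" .
qed

lemma infinite_meet_distributive_imp_projection_band:
  fixes H :: "'a::archimedean_vector_lattice set"
  assumes H: "H \<in> vl_ideals" and dist: "infinite_meet_distributive_at H"
  shows "projection_band H"
proof -
  have pos: "f \<in> H + disjoint_complement H" if "0 \<le> f" for f
  proof -
    define \<J> where "\<J> = {truncation_ideal f h n |h n. h \<in> H}"
    have "\<J> \<subseteq> vl_ideals"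
      by (auto simp: \<J>_def truncation_ideal_def disjoint_complement_ideal)
    moreover have "f \<in> (\<Inter>J\<in>\<J>. H + J)"
      using mem_ideal_add_truncation_ideal[OF H _ that] by (auto simp: \<J>_def)
    ultimately have "f \<in> H + \<Inter>\<J>"
      using dist unfolding infinite_meet_distributive_at_def by blast
    moreover have "\<Inter>\<J> \<subseteq> disjoint_complement H"
    proof
      fix g assume g: "g \<in> \<Inter>\<J>"
      have "inf \<bar>g\<bar> \<bar>h\<bar> = 0" if "h \<in> H" for h
        using g that
        by (intro truncation_ideals_Inter_disjoint[OF \<open>0 \<le> f\<close>]) (auto simp: \<J>_def)
      then show "g \<in> disjoint_complement H"
        by (simp add: disjoint_complement_def)
    qed
    ultimately show ?thesis
      by (rule subsetD[OF set_plus_mono2[OF order_refl], rotated])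
  qed
  have "f \<in> H + disjoint_complement H" for f
  proof -
    \<comment> \<open>The sum of two subspaces is a subspace, so positive and negative part suffice.\<close>
    have "subspace (H + disjoint_complement H)"
      using subspace_sums[OF vl_idealsD(1)[OF H] vl_idealsD(1)[OF disjoint_complement_ideal[of H]]]
      by (rule back_subst[of subspace]) (auto simp: set_plus_def)
    then have "pprt f - pprt (- f) \<in> H + disjoint_complement H"
      by (intro subspace_diff pos) simp_all
    then show ?thesis
      by (simp only: pprt_diff_pprt_uminus)
  qed
  with H show ?thesis
    by (auto simp: projection_band_def)
qed

theorem theorem3p6:
  fixes H :: "'a::archimedean_vector_lattice set"
  assumes "H \<in> vl_ideals"
  shows "projection_band H \<longleftrightarrow> infinite_meet_distributive_at H"
  using assms projection_band_imp_infinite_meet_distributive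
    infinite_meet_distributive_imp_projection_band by blast

end
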